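(* For every $i\in\mathbb{Z}_4$, the following two relations hold on every nonzero finite-dimensional $\square_q$-module $V$ (i.e. as equalities in $\mathrm{End}(V)$): $$\exp_q(\mathfrak{n}_{i,i+1})^{-1}\,x_{i}\,\exp_q(\mathfrak{n}_{i,i+1})=x_ix_{i+1}x_i,$$ $$\exp_q(\mathfrak{n}_{i,i+1})\,x_{i+1}\,\exp_q(\mathfrak{n}_{i,i+1})^{-1}=x_{i+1}x_ix_{i+1}.$$
   Context: Let $\mathbb{F}$ be an algebraically closed field and let $0\ne q\in\mathbb{F}$ be not a root of unity. Algebras are associative with $1$. For $n\in\mathbb{Z}$, $[n]_q=(q^n-q^{-n})/(q-q^{-1})$; for $n\in\mathbb{N}=\{0,1,2,\dots\}$, $[n]_q^!=\prod_{k=1}^n[k]_q$ with $[0]_q^!=1$. Let $\mathbb{Z}_4=\mathbb{Z}/4\mathbb{Z}$; indices are taken in $\mathbb{Z}_4$. $\square_q$ is the $\mathbb{F}$-algebra with generators $\{x_i\}_{i\in\mathbb{Z}_4}$ and relations, for $i\in\mathbb{Z}_4$, $$\frac{qx_ix_{i+1}-q^{-1}x_{i+1}x_i}{q-q^{-1}}=1,\qquad x_i^3x_{i+2}-[3]_qx_i^2x_{i+2}x_i+[3]_qx_ix_{i+2}x_i^2-x_{i+2}x_i^3=0.$$ For $i\in\mathbb{Z}_4$ put $\mathfrak{n}_{i,i+1}=\dfrac{q(1-x_ix_{i+1})}{q-q^{-1}}=\dfrac{q^{-1}(1-x_{i+1}x_i)}{q-q^{-1}}\in\square_q$. On every nonzero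 finite-dimensional $\square_q$-module each $\mathfrak{n}_{i,i+1}$ acts nilpotently. For a nilpotent $\psi\in\mathrm{End}(V)$, $V$ a nonzero finite-dimensional $\mathbb{F}$-vector space, $\exp_q(\psi)=\sum_{n\in\mathbb{N}}\frac{q^{\binom n2}}{[n]_q^!}\psi^n$, which is invertible. *)

theory Defs
  imports
    "HOL-Library.Poly_Mapping"
    "HOL-Library.Numeral_Type"
    "HOL-Computational_Algebra.Polynomial"
    "HOL-Algebra.QuotRing"
    "HOL-Algebra.Algebraic_Closure_Type"
begin

text \<open>
  The index set is the type \<open>4\<close>, whose arithmetic is that of the integers modulo \<open>4\<close>.
\<close>

section \<open>\<open>q\<close>-numbers\<close>

definition q_int :: "'f::field \<Rightarrow> int \<Rightarrow> 'f" where
  "q_int q n = (q powi n - q powi (- n)) / (q - inverse q)"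

definition q_fact :: "'f::field \<Rightarrow> nat \<Rightarrow> 'f" where
  "q_fact q n = (\<Prod>k=1..n. q_int q (int k))"

section \<open>The free algebra on four generators\<close>

text \<open>
  Words form an additively written monoid, because the convolution product of
  \<^theory>\<open>HOL-Library.Poly_Mapping\<close> is indexed by additive monoids. Hence
  finitely supported functions from words to a field form the free algebra.
\<close>

datatype word = Word (letters: "4 list")

instantiation word :: monoid_add
begin
definition zero_word where "zero_word = Word []"
definition plus_word where "plus_word u v = Word (letters u @ letters v)"
instance by standard (auto simp: zero_word_def plus_word_def)
end

type_synonym 'f free_alg = "word \<Rightarrow>\<^sub>0 'f"

definition scalar :: "'f::field \<Rightarrow> 'f free_alg" where
  "scalar c = Poly_Mapping.single 0 c"

definition gen :: "4 \<Rightarrow> 'f::field free_alg" where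
  "gen i = Poly_Mapping.single (Word [i]) 1"

abbreviation free_ring :: "'f::field free_alg ring" where
  "free_ring \<equiv> ring_of_type_algebra"

section \<open>The algebra \<open>\<box>\<^sub>q\<close>\<close>

definition relators :: "'f::field \<Rightarrow> 'f free_alg set" where
  "relators q =
     (\<Union>i::4. {scalar (1 / (q - inverse q)) *
               (scalar q * gen i * gen (i + 1) - scalar (inverse q) * gen (i + 1) * gen i) - 1,
             gen i ^ 3 * gen (i + 2)
               - scalar (q_int q 3) * gen i ^ 2 * gen (i + 2) * gen i
               + scalar (q_int q 3) * gen i * gen (i + 2) * gen i ^ 2
               - gen (i + 2) * gen i ^ 3})"

definition rel_ideal :: "'f::field \<Rightarrow> 'f free_alg set" where
  "rel_ideal q = Idl\<^bsub>free_ring\<^esub> (relators q)"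

definition square_q :: "'f::field \<Rightarrow> 'f free_alg set ring" where
  "square_q q = free_ring Quot (rel_ideal q)"

definition cls :: "'f::field \<Rightarrow> 'f free_alg \<Rightarrow> 'f free_alg set" where
  "cls q a = rel_ideal q +>\<^bsub>free_ring\<^esub> a"

definition sq_gen :: "'f::field \<Rightarrow> 4 \<Rightarrow> 'f free_alg set" where
  "sq_gen q i = cls q (gen i)"

text \<open>\<open>nfrak q i\<close> is the element \<open>\<nn>\<^bsub>i,i+1\<^esub>\<close> of \<open>\<box>\<^sub>q\<close>.\<close>

definition nfrak :: "'f::field \<Rightarrow> 4 \<Rightarrow> 'f free_alg set" where
  "nfrak q i = cls q (scalar (q / (q - inverse q)) * (1 - gen i * gen (i + 1)))"

section \<open>Modules\<close>

definition End_ring :: "('f::field \<Rightarrow> 'v::ab_group_add \<Rightarrow> 'v) \<Rightarrow> ('v \<Rightarrow> 'v) ring" where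
  "End_ring scale =
     \<lparr>carrier = {f. Vector_Spaces.linear scale scale f}, monoid.mult = (\<circ>), one = id,
      ring.zero = (\<lambda>_. 0), add = (\<lambda>f g v. f v + g v)\<rparr>"

text \<open>
  A \<open>\<box>\<^sub>q\<close>-module structure on a vector space is a homomorphism of algebras from \<open>\<box>\<^sub>q\<close> to
  its endomorphism algebra. The last conjunct says that this ring homomorphism is linear over
  the field.
\<close>

definition square_q_module ::
  "'f::field \<Rightarrow> ('f \<Rightarrow> 'v::ab_group_add \<Rightarrow> 'v) \<Rightarrow> ('f free_alg set \<Rightarrow> 'v \<Rightarrow> 'v) \<Rightarrow> bool" where
  "square_q_module q scale \<rho> \<longleftrightarrow>
     vector_space scale \<and>
     \<rho> \<in> ring_hom (square_q q) (End_ring scale) \<and>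
     (\<forall>c. \<rho> (cls q (scalar c)) = scale c)"

section \<open>The \<open>q\<close>-exponential\<close>

text \<open>
  \<^const>\<open>Sum_any\<close> sums a family of finite support (and is \<open>0\<close> otherwise); for nilpotent
  \<open>\<psi>\<close> the support below is finite.
\<close>

definition exp_q :: "'f::field \<Rightarrow> ('f \<Rightarrow> 'v::ab_group_add \<Rightarrow> 'v) \<Rightarrow> ('v \<Rightarrow> 'v) \<Rightarrow> 'v \<Rightarrow> 'v" where
  "exp_q q scale \<psi> =
     (\<lambda>v. Sum_any (\<lambda>n. scale (q ^ (n choose 2) / q_fact q n) ((\<psi> ^^ n) v)))"

lemma exp_q_nilpotent:
  assumes "vector_space scale" and "Vector_Spaces.linear scale scale \<psi>"
    and "\<And>v. (\<psi> ^^ N) v = 0"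
  shows "exp_q q scale \<psi> v = (\<Sum>n<N. scale (q ^ (n choose 2) / q_fact q n) ((\<psi> ^^ n) v))"
proof -
  interpret vector_space scale by fact
  have "(\<psi> ^^ n) v = 0" if "N \<le> n" for n
  proof -
    have "(\<psi> ^^ n) v = (\<psi> ^^ N) ((\<psi> ^^ (n - N)) v)"
      using that by (metis comp_apply funpow_add le_add_diff_inverse)
    then show ?thesis using assms(3) by simp
  qed
  then have "{n. scale (q ^ (n choose 2) / q_fact q n) ((\<psi> ^^ n) v) \<noteq> 0} \<subseteq> {..<N}"
    by (auto simp: not_less intro: leI)
  then show ?thesis
    unfolding exp_q_def by (intro Sum_any.expand_superset) auto
qed

section \<open>Consistency of the definitions\<close>

lemma ring_free_ring: "ring (free_ring :: 'f::field free_alg ring)"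
proof -
  have "\<exists>b. a + b = 0 \<and> b + a = 0" for a :: "'f free_alg"
    by (rule exI[of _ "- a"]) simp
  moreover have "\<exists>b. a + b = 0" for a :: "'f free_alg"
    by (rule exI[of _ "- a"]) simp
  ultimately show ?thesis
    unfolding ring_of_type_algebra_def
    by unfold_locales (auto simp: algebra_simps Units_def)
qed

lemma ideal_rel_ideal: "ideal (rel_ideal q) free_ring"
  unfolding rel_ideal_def
  by (rule ring.genideal_ideal[OF ring_free_ring]) (simp add: ring_of_type_algebra_def)

lemma ring_square_q: "ring (square_q q)"
  unfolding square_q_def by (rule ideal.quotient_is_ring[OF ideal_rel_ideal])

lemma cls_hom: "cls q \<in> ring_hom free_ring (square_q q)"
  unfolding square_q_def cls_def[abs_def] by (rule ideal.rcos_ring_hom[OF ideal_rel_ideal])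

lemma cls_eq_iff: "cls q a = cls q b \<longleftrightarrow> a - b \<in> rel_ideal q"
proof -
  interpret ideal "rel_ideal q" free_ring by (rule ideal_rel_ideal)
  have "a \<ominus>\<^bsub>free_ring\<^esub> b = a - b"
  proof -
    have "\<ominus>\<^bsub>free_ring\<^esub> b = - b"
      by (rule minus_equality) (auto simp: ring_of_type_algebra_def)
    then show ?thesis by (simp add: a_minus_def ring_of_type_algebra_def)
  qed
  then show ?thesis
    unfolding cls_def using quotient_eq_iff_same_a_r_cos[OF ideal_rel_ideal, of a b]
    by (simp add: ring_of_type_algebra_def)
qed

lemma scalar_mult: "scalar a * scalar b = scalar (a * b)"
  by (simp add: scalar_def mult_single)

lemma scalar_one: "scalar 1 = 1"
  by (simp add: scalar_def)

lemma scalar_add: "scalar (a + b) = scalar a + scalar b"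
  by (simp add: scalar_def single_add)

text \<open>The two expressions for \<open>\<nn>\<^bsub>i,i+1\<^esub>\<close> agree in \<open>\<box>\<^sub>q\<close>.\<close>

lemma nfrak_alt:
  assumes "q - inverse q \<noteq> 0"
  shows "nfrak q i = cls q (scalar (inverse q / (q - inverse q)) * (1 - gen (i + 1) * gen i))"
proof -
  interpret ideal "rel_ideal q" free_ring by (rule ideal_rel_ideal)
  define d where "d = q - inverse q"
  have d: "d \<noteq> 0" using assms by (simp add: d_def)
  let ?r = "scalar (1 / d) *
    (scalar q * gen i * gen (i + 1) - scalar (inverse q) * gen (i + 1) * gen i) - 1"
  have "?r \<in> relators q" unfolding relators_def d_def by blast
  then have "?r \<in> rel_ideal q"
    unfolding rel_ideal_def using ring.genideal_self[OF ring_free_ring, of "relators q"]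
    by (auto simp: ring_of_type_algebra_def)
  then have "scalar (- 1) * ?r \<in> rel_ideal q"
    using I_l_closed[of ?r "scalar (- 1)"] by (simp add: ring_of_type_algebra_def)
  moreover have "scalar (- 1) = (- 1 :: 'a free_alg)"
    by (simp add: scalar_def single_uminus)
  moreover have "- ?r = scalar (q / d) * (1 - gen i * gen (i + 1)) -
      scalar (inverse q / d) * (1 - gen (i + 1) * gen i)"
  proof -
    have "q / d - inverse q / d = d / d"
      by (simp only: diff_divide_distrib[symmetric] d_def[symmetric])
    then have "q / d - inverse q / d = 1"
      using d by simp
    then have "q / d = inverse q / d + 1"
      by (simp only: diff_eq_eq add.commute)
    then have 1: "scalar (q / d) = scalar (inverse q / d) + (1 :: 'a free_alg)"
      by (simp only: scalar_one[symmetric] scalar_add[symmetric])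
    have 2: "scalar (1 / d) * (scalar c * a * b) = scalar (c / d) * (a * b)"
      for c and a b :: "'a free_alg"
      by (simp add: mult.assoc[symmetric] scalar_mult)
    have "?r = scalar (q / d) * (gen i * gen (i + 1))
        - scalar (inverse q / d) * (gen (i + 1) * gen i) - 1"
      by (simp only: right_diff_distrib 2)
    then show ?thesis
      using 1 by (simp add: right_diff_distrib)
  qed
  ultimately show ?thesis
    unfolding nfrak_def cls_eq_iff d_def by simp
qed

end

theory Submission
  imports Defs
begin

text \<open>
  Write \<open>x\<close>, \<open>y\<close> and \<open>N\<close> for the actions of \<open>x\<^sub>i\<close>, \<open>x\<^bsub>i+1\<^esub>\<close> and \<open>\<nn>\<^bsub>i,i+1\<^esub>\<close> on the
  module. The two expressions for \<open>\<nn>\<^bsub>i,i+1\<^esub>\<close> say \<open>xy = 1 - q\<^sup>-\<^sup>1(q - q\<^sup>-\<^sup>1)N\<close> and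
  \<open>yx = 1 - q(q - q\<^sup>-\<^sup>1)N\<close>, and comparing the two ways of reading \<open>xyx\<close> and \<open>yxy\<close> gives
  \<open>Nx = q\<^sup>2xN\<close> and \<open>Ny = q\<^sup>-\<^sup>2yN\<close>. Hence \<open>x f(N) = f(q\<^sup>-\<^sup>2N) x\<close> and \<open>f(N) y = y f(q\<^sup>-\<^sup>2N)\<close>
  for every polynomial \<open>f\<close>.

  The \<open>q\<close>-exponential is characterised by the functional equation
  \<open>exp\<^sub>q(q\<^sup>-\<^sup>2z) = exp\<^sub>q(z)(1 - q\<^sup>-\<^sup>1(q - q\<^sup>-\<^sup>1)z)\<close>, an identity of coefficients
  (\<open>exp_coeff_recursion\<close>). At \<open>z = N\<close> the second factor is \<open>xy\<close>, so with \<open>E = exp\<^sub>q(N)\<close> one gets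
  \<open>xE = E xyx\<close> and \<open>Ey = yxy E\<close>; these are the two claims once \<open>E\<close> is invertible.

  That \<open>N\<close> is nilpotent is part of what must be shown,
  since the series is a finite sum only for a nilpotent argument.
  Suppose \<open>N\<close> has an eigenvalue \<open>c \<noteq> 0\<close>. By the commutation rules \<open>x\<close> and \<open>y\<close> move
  eigenvectors to the eigenvalues \<open>q\<^sup>2c, q\<^sup>4c, \<dots>\<close> and \<open>q\<^sup>-\<^sup>2c, q\<^sup>-\<^sup>4c, \<dots>\<close>. These are pairwise distinct,
  so in finite dimension both ladders stop, at eigenvectors killed by \<open>x\<close> and by \<open>y\<close>. There
  \<open>yx = 0\<close> and \<open>xy = 0\<close> force the eigenvalues \<open>q\<^sup>-\<^sup>1/(q - q\<^sup>-\<^sup>1)\<close> and \<open>q/(q - q\<^sup>-\<^sup>1)\<close>; their ratio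
  \<open>q\<^sup>-\<^sup>2\<close> would have to be a nonnegative power of \<open>q\<^sup>2\<close>, which makes \<open>q\<close> a root of unity. Thus
  all eigenvalues of \<open>N\<close> are \<open>0\<close>, and over an algebraically closed field \<open>N\<close> is nilpotent.
\<close>

section \<open>Polynomials in an endomorphism\<close>

definition poly_op :: "('f::field \<Rightarrow> 'v::ab_group_add \<Rightarrow> 'v) \<Rightarrow> ('v \<Rightarrow> 'v) \<Rightarrow> 'f poly \<Rightarrow> 'v \<Rightarrow> 'v" where
  "poly_op scale T p v = (\<Sum>i\<le>degree p. scale (coeff p i) ((T ^^ i) v))"

locale endomorphism = vector_space scale + T: Vector_Spaces.linear scale scale T
  for scale :: "'f::field \<Rightarrow> 'v::ab_group_add \<Rightarrow> 'v" (infixr "*s" 75)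
    and T :: "'v \<Rightarrow> 'v"
begin

lemma linear_funpow: "Vector_Spaces.linear scale scale (T ^^ n)"
proof (induction n)
  case 0
  show ?case using linear_id by (simp add: id_def[symmetric])
next
  case (Suc n)
  then show ?case
    using Vector_Spaces.linear_compose[OF Suc T.linear_axioms] by (simp add: o_def)
qed

lemma funpow_simps [simp]:
  "(T ^^ n) 0 = 0" "(T ^^ n) (u + v) = (T ^^ n) u + (T ^^ n) v"
  "(T ^^ n) (u - v) = (T ^^ n) u - (T ^^ n) v" "(T ^^ n) (c *s v) = c *s (T ^^ n) v"
proof -
  interpret P: Vector_Spaces.linear scale scale "T ^^ n" by (rule linear_funpow)
  show "(T ^^ n) 0 = 0" "(T ^^ n) (u + v) = (T ^^ n) u + (T ^^ n) v"
    "(T ^^ n) (u - v) = (T ^^ n) u - (T ^^ n) v" "(T ^^ n) (c *s v) = c *s (T ^^ n) v"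
    by (simp_all add: P.zero P.add P.diff P.scale)
qed

text \<open>
  The degree of a sum or product varies with the polynomials, so proofs about \<^const>\<open>poly_op\<close> need
  the freedom to sum up to any common bound.
\<close>

lemma poly_op_eq_sum:
  assumes "degree p \<le> n"
  shows "poly_op scale T p v = (\<Sum>i\<le>n. coeff p i *s (T ^^ i) v)"
  unfolding poly_op_def using assms
  by (intro sum.mono_neutral_left) (auto simp: coeff_eq_0)

lemma poly_op_0 [simp]: "poly_op scale T 0 v = 0"
  by (simp add: poly_op_def)

lemma poly_op_pCons: "poly_op scale T (pCons a p) v = a *s v + T (poly_op scale T p v)"
proof -
  have "poly_op scale T (pCons a p) v
      = (\<Sum>i\<le>Suc (degree p). coeff (pCons a p) i *s (T ^^ i) v)"
    by (rule poly_op_eq_sum) (rule degree_pCons_le)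
  also have "\<dots> = a *s v + (\<Sum>i\<le>degree p. coeff p i *s T ((T ^^ i) v))"
    by (simp only: sum.atMost_Suc_shift) simp
  finally show ?thesis
    by (simp add: poly_op_def T.sum T.scale)
qed

lemma poly_op_add: "poly_op scale T (p + r) v = poly_op scale T p v + poly_op scale T r v"
proof -
  define n where "n = max (degree p) (degree r)"
  have "degree p \<le> n" "degree r \<le> n" "degree (p + r) \<le> n"
    by (auto simp: n_def intro: degree_add_le)
  then show ?thesis
    by (simp add: poly_op_eq_sum[of _ n] sum.distrib scale_left_distrib)
qed

lemma poly_op_smult: "poly_op scale T (smult c p) v = c *s poly_op scale T p v"
  by (simp add: poly_op_eq_sum[of _ "degree p"] degree_smult_le scale_sum_right)

lemma poly_op_mult: "poly_op scale T (p * r) v = poly_op scale T p (poly_op scale T r v)"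
  by (induction p rule: pCons_induct)
    (simp_all add: poly_op_add poly_op_smult poly_op_pCons)

lemma poly_op_monom: "poly_op scale T (monom c n) v = c *s (T ^^ n) v"
  by (induction n) (simp_all add: monom_0 monom_Suc poly_op_pCons T.zero T.scale)

lemma poly_op_sum: "poly_op scale T (\<Sum>a\<in>A. f a) v = (\<Sum>a\<in>A. poly_op scale T (f a) v)"
  by (induction A rule: infinite_finite_induct) (simp_all add: poly_op_add)

lemma poly_op_eigenvector:
  assumes "T v = c *s v"
  shows "poly_op scale T p v = poly p c *s v"
  by (induction p rule: pCons_induct)
    (simp_all add: poly_op_pCons T.scale assms scale_left_distrib mult.commute)

lemma linear_poly_op: "Vector_Spaces.linear scale scale (poly_op scale T p)"
  unfolding poly_op_def
  by (intro Vector_Spaces.linear.intro vector_space_axioms module_hom.intro module_axioms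
      module_hom_axioms.intro)
    (simp_all add: scale_right_distrib sum.distrib scale_sum_right mult.commute)

end

locale fd_endomorphism = finite_dimensional_vector_space scale Basis + endomorphism scale T
  for scale :: "'f::field \<Rightarrow> 'v::ab_group_add \<Rightarrow> 'v" (infixr "*s" 75)
    and Basis :: "'v set" and T :: "'v \<Rightarrow> 'v"
begin

text \<open>
  Either two powers \<open>T\<^sup>i v\<close> and \<open>T\<^sup>j v\<close> coincide, or the powers form an infinite set, which is
  linearly dependent in finite dimension; both situations are polynomial relations.
\<close>

lemma annihilating_poly_of_vector: "\<exists>p. p \<noteq> 0 \<and> poly_op scale T p v = 0"
proof (cases "inj (\<lambda>i. (T ^^ i) v)")
  case False
  then obtain i j where ij: "i \<noteq> j" "(T ^^ i) v = (T ^^ j) v"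
    by (auto simp: inj_def)
  have "coeff (monom 1 i + smult (- 1) (monom (1::'f) j)) i = 1"
    using ij(1) by simp
  then have "monom 1 i + smult (- 1) (monom (1::'f) j) \<noteq> 0"
    by (metis coeff_0 zero_neq_one)
  moreover have "poly_op scale T (monom 1 i + smult (- 1) (monom 1 j)) v = 0"
    unfolding poly_op_add poly_op_smult poly_op_monom using ij(2) by simp
  ultimately show ?thesis by blast
next
  case True
  let ?w = "\<lambda>i. (T ^^ i) v"
  have "dependent (range ?w)"
    using finiteI_independent[of "range ?w"] True range_inj_infinite by blast
  then obtain S u where S: "finite S" "S \<subseteq> range ?w" "(\<Sum>w\<in>S. u w *s w) = 0"
    and nz: "\<exists>w\<in>S. u w \<noteq> 0"
    unfolding dependent_explicit by blast
  define I where "I = ?w -` S"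
  have I: "finite I" "?w ` I = S"
    using S(1,2) True by (auto simp: I_def intro: finite_vimageI)
  define p where "p = (\<Sum>i\<in>I. monom (u (?w i)) i)"
  have "poly_op scale T p v = (\<Sum>i\<in>I. u (?w i) *s ?w i)"
    by (simp add: p_def poly_op_sum poly_op_monom)
  also have "\<dots> = (\<Sum>w\<in>?w ` I. u w *s w)"
    using inj_on_subset[OF True, of I] by (simp add: sum.reindex)
  finally have "poly_op scale T p v = 0"
    using S(3) I(2) by simp
  moreover from nz I(2) obtain i where i: "i \<in> I" "u (?w i) \<noteq> 0"
    by blast
  then have "coeff p i \<noteq> 0"
    using I(1) by (simp add: p_def coeff_sum)
  then have "p \<noteq> 0" by auto
  ultimately show ?thesis by blast
qed

text \<open>
  Polynomials in \<open>T\<close> commute, so the product of annihilating polynomials of the basis vectors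
  annihilates each of them.
\<close>

lemma annihilating_poly: "\<exists>p. p \<noteq> 0 \<and> (\<forall>v. poly_op scale T p v = 0)"
proof -
  obtain f where f: "\<And>v. f v \<noteq> 0" "\<And>v. poly_op scale T (f v) v = 0"
    using annihilating_poly_of_vector by metis
  define p where "p = (\<Prod>b\<in>Basis. f b)"
  interpret P: Vector_Spaces.linear scale scale "poly_op scale T p"
    by (rule linear_poly_op)
  have "poly_op scale T p b = 0" if "b \<in> Basis" for b
  proof -
    have "p = (\<Prod>c\<in>Basis - {b}. f c) * f b"
      unfolding p_def using finite_Basis that by (simp add: prod.remove mult.commute)
    then have "poly_op scale T p b = poly_op scale T (\<Prod>c\<in>Basis - {b}. f c) 0"
      by (simp add: poly_op_mult f(2))
    also have "\<dots> = 0"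
      by (simp add: poly_op_def)
    finally show ?thesis .
  qed
  then have "poly_op scale T p v = 0" for v
    using P.eq_0_on_span[of Basis v] span_Basis by auto
  moreover have "p \<noteq> 0"
    using f(1) finite_Basis by (simp add: p_def)
  ultimately show ?thesis by blast
qed

end

locale alg_closed_endomorphism = fd_endomorphism scale Basis T
  for scale :: "'f::alg_closed_field \<Rightarrow> 'v::ab_group_add \<Rightarrow> 'v" (infixr "*s" 75)
    and Basis :: "'v set" and T :: "'v \<Rightarrow> 'v"
begin

text \<open>
  Split off the linear factors \<open>T - c\<close> one at a time: for \<open>c \<noteq> 0\<close> the factor is injective and can
  be cancelled, for \<open>c = 0\<close> it contributes one factor \<open>T\<close> to the power. The induction runs over
  all \<open>v\<close>, because in the second case the remaining polynomial annihilates \<open>T v\<close> instead of \<open>v\<close>.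
\<close>

lemma nilpotent_on_poly_kernel:
  assumes no_eig: "\<And>c v. c \<noteq> 0 \<Longrightarrow> T v = c *s v \<Longrightarrow> v = 0"
    and "p \<noteq> 0" "poly_op scale T p v = 0"
  shows "(T ^^ degree p) v = 0"
  using assms(2,3)
proof (induction "degree p" arbitrary: p v)
  case 0
  then obtain a where "p = [:a:]"
    by (metis degree_eq_zeroE)
  with "0.prems" show ?case
    by (simp add: poly_op_def)
next
  case (Suc n)
  then obtain c where "poly p c = 0"
    using alg_closed_imp_poly_has_root[of p] by auto
  then obtain r where p: "p = [:- c, 1:] * r"
    by (auto simp: poly_eq_0_iff_dvd elim: dvdE)
  with Suc.prems(1) have r: "r \<noteq> 0"
    by auto
  have "degree p = Suc (degree r)"
    unfolding p using r by (subst degree_mult_eq) auto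
  with Suc.hyps(2) have deg: "degree r = n" "degree p = Suc n"
    by simp_all
  have "T (poly_op scale T r v) - c *s poly_op scale T r v = 0"
    using Suc.prems(2) unfolding p poly_op_mult
    by (simp add: poly_op_pCons T.zero T.scale)
  then have eig: "T (poly_op scale T r v) = c *s poly_op scale T r v"
    by simp
  show ?case
  proof (cases "c = 0")
    case True
    have "poly_op scale T r (T v) = T (poly_op scale T r v)"
      by (simp add: poly_op_def T.sum T.scale funpow_swap1)
    also have "\<dots> = 0"
      using eig True by simp
    finally have "(T ^^ degree r) (T v) = 0"
      using Suc.hyps(1)[of r "T v"] deg r by simp
    then show ?thesis
      using deg by (simp add: funpow_swap1)
  next
    case False
    then have "poly_op scale T r v = 0"
      using no_eig eig by blast
    then have "(T ^^ degree r) v = 0"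
      using Suc.hyps(1)[of r v] deg r by simp
    then show ?thesis
      using deg by (simp add: T.zero)
  qed
qed

lemma nilpotent_if_no_nonzero_eigenvalue:
  assumes "\<And>c v. c \<noteq> 0 \<Longrightarrow> T v = c *s v \<Longrightarrow> v = 0"
  shows "\<exists>n. \<forall>v. (T ^^ n) v = 0"
proof -
  obtain p where p: "p \<noteq> 0" "\<And>v. poly_op scale T p v = 0"
    using annihilating_poly by blast
  have "(T ^^ degree p) v = 0" for v
    by (rule nilpotent_on_poly_kernel[OF _ p]) (rule assms)
  then show ?thesis
    by blast
qed

text \<open>
  The vector \<open>A\<^sup>k v\<close>, if nonzero, is an eigenvector for \<open>s\<^sup>k c\<close>. These scalars are pairwise
  distinct, and each eigenvalue is a root of an annihilating polynomial, so only finitely many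
  of them can occur.
\<close>

lemma eigenvalue_ladder_terminates:
  assumes A: "Vector_Spaces.linear scale scale A" and comm: "\<And>v. T (A v) = s *s A (T v)"
    and s: "s \<noteq> 0" "\<And>n::nat. n > 0 \<Longrightarrow> s ^ n \<noteq> 1"
    and v: "v \<noteq> 0" "T v = c *s v" and c: "c \<noteq> 0"
  shows "\<exists>k w. w \<noteq> 0 \<and> A w = 0 \<and> T w = (s ^ k * c) *s w"
proof -
  interpret A: Vector_Spaces.linear scale scale A by fact
  have eig: "T ((A ^^ k) v) = (s ^ k * c) *s (A ^^ k) v" for k
    by (induction k) (simp_all add: v comm A.scale mult_ac)
  obtain p where p: "p \<noteq> 0" "\<And>v. poly_op scale T p v = 0"
    using annihilating_poly by blast
  have "inj (\<lambda>k. s ^ k * c)"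
  proof (rule linorder_injI)
    fix i j :: nat assume "i < j"
    then have "s ^ j = s ^ i * s ^ (j - i)"
      by (simp flip: power_add)
    with s(2)[of "j - i"] \<open>i < j\<close> s(1) c show "s ^ i * c \<noteq> s ^ j * c"
      by simp
  qed
  then have "infinite (range (\<lambda>k. s ^ k * c))"
    by (rule range_inj_infinite)
  moreover have "finite {x. poly p x = 0}"
    using p(1) by (rule poly_roots_finite)
  ultimately obtain k where "poly p (s ^ k * c) \<noteq> 0"
    using finite_subset[of "range (\<lambda>k. s ^ k * c)" "{x. poly p x = 0}"] by blast
  moreover have "poly p (s ^ k * c) *s (A ^^ k) v = 0"
    using poly_op_eigenvector[OF eig, of p k] p(2) by simp
  ultimately have Ak: "(A ^^ k) v = 0"
    by simp
  \<comment> \<open>The last nonzero vector of the ladder is the witness.\<close>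
  define m where "m = (LEAST k. (A ^^ k) v = 0)"
  have m: "(A ^^ m) v = 0"
    unfolding m_def using Ak by (rule LeastI)
  with v(1) obtain j where j: "m = Suc j"
    by (cases m) auto
  then have "(A ^^ j) v \<noteq> 0"
    using not_less_Least[of j "\<lambda>k. (A ^^ k) v = 0"] by (simp add: m_def)
  then show ?thesis
    using m j eig[of j] by (intro exI[of _ j] exI[of _ "(A ^^ j) v"]) simp
qed

end

section \<open>The relation between two neighbouring generators\<close>

text \<open>
  The operator \<open>N\<close> stands for the action of \<open>\<nn>\<^bsub>i,i+1\<^esub>\<close>. The defining relation of \<open>x\<^sub>i\<close> and
  \<open>x\<^bsub>i+1\<^esub>\<close> enters only through the two assumptions below, from which it is recovered
  by eliminating \<open>N\<close>.
\<close>

locale q_weyl_pair =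
  alg_closed_endomorphism scale Basis N
    + x: Vector_Spaces.linear scale scale x + y: Vector_Spaces.linear scale scale y
  for q :: "'f::alg_closed_field" and scale :: "'f \<Rightarrow> 'v::ab_group_add \<Rightarrow> 'v" (infixr "*s" 75)
    and Basis :: "'v set" and x y N :: "'v \<Rightarrow> 'v" +
  assumes q_nonzero: "q \<noteq> 0"
    and q_not_root_of_unity: "n > 0 \<Longrightarrow> q ^ n \<noteq> 1"
    and xy: "x (y v) = v - (inverse q * (q - inverse q)) *s N v"
    and yx: "y (x v) = v - (q * (q - inverse q)) *s N v"
begin

lemma d_nonzero: "q - inverse q \<noteq> 0"
  using q_not_root_of_unity[of 2] q_nonzero by (auto simp: power2_eq_square field_simps)

text \<open>
  Both sides are multiples of \<open>x - xyx\<close>: evaluate \<open>(xy)x\<close> with the first relation and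
  \<open>x(yx)\<close> with the second.
\<close>

lemma N_x: "N (x v) = q\<^sup>2 *s x (N v)"
proof -
  have q: "q * (inverse q * d) = d" "q * (q * d) = d * q\<^sup>2" for d
    using q_nonzero by (simp add: mult.assoc[symmetric], simp add: power2_eq_square mult_ac)
  have "(inverse q * (q - inverse q)) *s N (x v) = (q * (q - inverse q)) *s x (N v)"
    using xy[of "x v"] arg_cong[OF yx[of v], of x] by (simp add: x.diff x.scale)
  then have "(q * (inverse q * (q - inverse q))) *s N (x v)
      = (q * (q * (q - inverse q))) *s x (N v)"
    by (metis scale_scale)
  then have "(q - inverse q) *s N (x v) = (q - inverse q) *s q\<^sup>2 *s x (N v)"
    by (simp only: q scale_scale)
  then show ?thesis
    using d_nonzero by (simp del: scale_scale)
qed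

lemma N_y: "N (y v) = (inverse q)\<^sup>2 *s y (N v)"
proof -
  have q: "inverse q * (q * d) = d" "inverse q * (inverse q * d) = d * (inverse q)\<^sup>2" for d
    using q_nonzero by (simp add: mult.assoc[symmetric], simp add: power2_eq_square mult_ac)
  have "(q * (q - inverse q)) *s N (y v) = (inverse q * (q - inverse q)) *s y (N v)"
    using yx[of "y v"] arg_cong[OF xy[of v], of y] by (simp add: y.diff y.scale)
  then have "(inverse q * (q * (q - inverse q))) *s N (y v)
      = (inverse q * (inverse q * (q - inverse q))) *s y (N v)"
    by (metis scale_scale)
  then have "(q - inverse q) *s N (y v) = (q - inverse q) *s (inverse q)\<^sup>2 *s y (N v)"
    by (simp only: q scale_scale)
  then show ?thesis
    using d_nonzero by (simp del: scale_scale)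
qed

lemma x_N: "x (N v) = (inverse q)\<^sup>2 *s N (x v)"
  using q_nonzero by (simp add: N_x power_inverse)

lemma q2_not_root_of_unity: "n > 0 \<Longrightarrow> (q\<^sup>2) ^ n \<noteq> 1"
  using q_not_root_of_unity[of "2 * n"] by (simp add: power_mult)

text \<open>
  A nonzero eigenvalue starts two ladders, one upwards along \<open>x\<close> and one downwards along \<open>y\<close>, whose
  ends have incompatible eigenvalues.
\<close>

lemma N_nilpotent: "\<exists>n. \<forall>v. (N ^^ n) v = 0"
proof (rule nilpotent_if_no_nonzero_eigenvalue, rule ccontr)
  fix c v assume c: "c \<noteq> 0" and v: "N v = c *s v" "v \<noteq> 0"
  let ?d = "q - inverse q"
  have inv: "n > 0 \<Longrightarrow> ((inverse q)\<^sup>2) ^ n \<noteq> 1" for n :: nat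
    using q2_not_root_of_unity[of n] by (simp add: power_inverse)
  obtain k w where w: "w \<noteq> 0" "x w = 0" "N w = ((q\<^sup>2) ^ k * c) *s w"
    using eigenvalue_ladder_terminates[OF x.linear_axioms N_x _ q2_not_root_of_unity v(2,1) c]
      q_nonzero by auto
  obtain m z where z: "z \<noteq> 0" "y z = 0" "N z = (((inverse q)\<^sup>2) ^ m * c) *s z"
    using eigenvalue_ladder_terminates[OF y.linear_axioms N_y _ inv v(2,1) c]
      q_nonzero by auto
  \<comment> \<open>At the ends of the ladders \<open>yx = 0\<close> and \<open>xy = 0\<close>, which determines the eigenvalues.\<close>
  have "(1 - q * ?d * ((q\<^sup>2) ^ k * c)) *s w = 0"
    using yx[of w] w by (simp add: y.zero scale_left_diff_distrib)
  then have 1: "q * ?d * ((q\<^sup>2) ^ k * c) = 1"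
    using w(1) by simp
  have "(1 - inverse q * ?d * (((inverse q)\<^sup>2) ^ m * c)) *s z = 0"
    using xy[of z] z by (simp add: x.zero scale_left_diff_distrib)
  then have 2: "inverse q * ?d * (((inverse q)\<^sup>2) ^ m * c) = 1"
    using z(1) by simp
  have qm: "(q\<^sup>2) ^ m * ((inverse q)\<^sup>2) ^ m = 1"
    using q_nonzero by (simp add: power_inverse)
  \<comment> \<open>Equation 1 divided by equation 2, with the powers of \<open>q\<close> collected.\<close>
  have "(q\<^sup>2) ^ (k + m + 1) = (q * (q\<^sup>2) ^ k) * (q\<^sup>2) ^ m * q
      * (inverse q * ?d * (((inverse q)\<^sup>2) ^ m * c))"
    unfolding 2 by (simp add: power_add power2_eq_square mult_ac)
  also have "\<dots> = (q * ?d * ((q\<^sup>2) ^ k * c)) * ((q\<^sup>2) ^ m * ((inverse q)\<^sup>2) ^ m) * (q * inverse q)"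
    by (simp only: mult_ac)
  also have "\<dots> = 1"
    unfolding 1 qm using q_nonzero by simp
  finally show False
    using q2_not_root_of_unity[of "k + m + 1"] by simp
qed

definition exp_coeff :: "nat \<Rightarrow> 'f" where
  "exp_coeff n = q ^ (n choose 2) / q_fact q n"

lemma q_int_nonzero: "q_int q (int (Suc n)) \<noteq> 0"
proof
  assume "q_int q (int (Suc n)) = 0"
  then have "q ^ Suc n = inverse (q ^ Suc n)"
    using d_nonzero by (simp add: q_int_def power_int_minus del: power_Suc of_nat_Suc)
  then have "q ^ Suc n * q ^ Suc n = 1"
    using q_nonzero by (metis power_not_zero right_inverse)
  then show False
    using q_not_root_of_unity[of "Suc n + Suc n"] by (simp only: power_add) simp
qed

lemma exp_coeff_0: "exp_coeff 0 = 1"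
  by (simp add: exp_coeff_def q_fact_def binomial_eq_0)

lemma exp_coeff_Suc: "exp_coeff (Suc n) * q_int q (int (Suc n)) = q ^ n * exp_coeff n"
proof -
  have "q_fact q (Suc n) = q_fact q n * q_int q (int (Suc n))"
    by (simp add: q_fact_def)
  moreover have "Suc n choose 2 = n + (n choose 2)"
    by (simp add: numeral_2_eq_2)
  ultimately show ?thesis
    using q_int_nonzero[of n] by (simp add: exp_coeff_def power_add)
qed

text \<open>
  The coefficient of \<open>z\<^bsup>n+1\<^esup>\<close> in \<open>exp\<^sub>q(q\<^sup>-\<^sup>2z) + q\<^sup>-\<^sup>1(q - q\<^sup>-\<^sup>1)z exp\<^sub>q(z) = exp\<^sub>q(z)\<close>. It is the
  recursion \<open>[n+1]\<^sub>q e\<^bsub>n+1\<^esub> = q\<^sup>n e\<^sub>n\<close> for the coefficients \<open>e\<^sub>n\<close>, multiplied by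
  \<open>q\<^bsup>-n-1\<^esup>(q - q\<^sup>-\<^sup>1)\<close>.
\<close>

lemma exp_coeff_recursion:
  "((inverse q)\<^sup>2) ^ Suc n * exp_coeff (Suc n) + inverse q * (q - inverse q) * exp_coeff n
    = exp_coeff (Suc n)"
proof -
  let ?d = "q - inverse q" and ?Q = "q ^ Suc n" and ?I = "inverse q ^ Suc n"
  have IQ: "?I * ?Q = 1"
    unfolding power_mult_distrib[symmetric] using q_nonzero by simp
  have "?d * q_int q (int (Suc n)) = ?Q - ?I"
    using d_nonzero
    by (simp add: q_int_def power_int_minus power_inverse del: power_Suc of_nat_Suc)
  then have "exp_coeff (Suc n) * (?Q - ?I) = ?d * (q ^ n * exp_coeff n)"
    using exp_coeff_Suc[of n] by (metis mult.left_commute)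
  then have "?I * (exp_coeff (Suc n) * (?Q - ?I)) = ?I * (?d * (q ^ n * exp_coeff n))"
    by simp
  also have "\<dots> = (q ^ n * inverse q ^ n) * (inverse q * ?d * exp_coeff n)"
    by (simp add: mult_ac)
  also have "q ^ n * inverse q ^ n = 1"
    using q_nonzero by (simp add: power_inverse)
  finally have "?I * ?Q * exp_coeff (Suc n) - ?I * ?I * exp_coeff (Suc n)
      = inverse q * ?d * exp_coeff n"
    by (simp add: algebra_simps)
  moreover have "?I * ?I = ((inverse q)\<^sup>2) ^ Suc n"
    by (simp only: power2_eq_square power_mult_distrib)
  ultimately have "exp_coeff (Suc n) - ((inverse q)\<^sup>2) ^ Suc n * exp_coeff (Suc n)
      = inverse q * ?d * exp_coeff n"
    by (simp only: IQ mult_1_left)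
  then show ?thesis
    by (metis add.commute diff_eq_eq)
qed

definition E :: "'v \<Rightarrow> 'v" where
  "E = exp_q q scale N"

lemma E_eq_sum:
  assumes "\<And>v. (N ^^ K) v = 0"
  shows "E v = (\<Sum>n<K. exp_coeff n *s (N ^^ n) v)"
  unfolding E_def exp_coeff_def
  by (rule exp_q_nilpotent[OF vector_space_axioms T.linear_axioms assms])

lemma linear_E: "Vector_Spaces.linear scale scale E"
proof -
  obtain K where K: "\<And>v. (N ^^ K) v = 0"
    using N_nilpotent by blast
  show ?thesis
    by (intro Vector_Spaces.linear.intro vector_space_axioms module_hom.intro module_axioms
        module_hom_axioms.intro)
      (simp_all add: E_eq_sum[OF K] scale_right_distrib sum.distrib scale_sum_right mult.commute)
qed

sublocale E: Vector_Spaces.linear scale scale E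
  by (rule linear_E)

lemma E_N: "E (N v) = N (E v)"
proof -
  obtain K where K: "\<And>v. (N ^^ K) v = 0"
    using N_nilpotent by blast
  show ?thesis
    by (simp add: E_eq_sum[OF K] T.sum T.scale funpow_swap1)
qed

text \<open>
  \<open>E\<close> is the identity plus a multiple of \<open>N\<close>. If \<open>E v = 0\<close> with \<open>v \<noteq> 0\<close>, then the last
  nonzero \<open>N\<^sup>j v\<close> is fixed by \<open>E\<close> and is also mapped to \<open>N\<^sup>j (E v) = 0\<close>.
\<close>

lemma inj_E: "inj E"
proof -
  have "v = 0" if "E v = 0" for v
  proof (rule ccontr)
    assume "v \<noteq> 0"
    obtain K where K: "\<And>v. (N ^^ K) v = 0"
      using N_nilpotent by blast
    define m where "m = (LEAST k. (N ^^ k) v = 0)"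
    have m: "(N ^^ m) v = 0"
      unfolding m_def using K by (rule LeastI)
    with \<open>v \<noteq> 0\<close> obtain j where j: "m = Suc j"
      by (cases m) auto
    then have nz: "(N ^^ j) v \<noteq> 0"
      using not_less_Least[of j "\<lambda>k. (N ^^ k) v = 0"] by (simp add: m_def)
    have Nn: "(N ^^ Suc n) ((N ^^ j) v) = 0" for n
    proof -
      have "(N ^^ Suc n) ((N ^^ j) v) = (N ^^ (n + m)) v"
        by (simp add: j funpow_add funpow_swap1)
      then show ?thesis
        by (simp add: funpow_add m)
    qed
    have "E ((N ^^ j) v) = (\<Sum>n<Suc K. exp_coeff n *s (N ^^ n) ((N ^^ j) v))"
      using K by (intro E_eq_sum) (simp add: T.zero)
    also have "\<dots> = (N ^^ j) v"
      unfolding sum.lessThan_Suc_shift Nn by (simp add: exp_coeff_0)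
    also have "E ((N ^^ j) v) = (N ^^ j) (E v)"
      by (induction j) (simp_all add: E_N)
    finally show False
      using nz that by simp
  qed
  then show ?thesis
    using E.inj_iff_eq_0 by blast
qed

text \<open>
  The functional equation \<open>exp\<^sub>q(q\<^sup>-\<^sup>2N) = exp\<^sub>q(N) xy\<close>. With \<open>N\<^sup>K = 0\<close>, the left-hand sum
  includes the vanishing term \<open>n = K\<close>, so that the shifted sum \<open>N exp\<^sub>q(N)\<close> matches it term by term.
\<close>

lemma E_rescale:
  assumes "\<And>v. (N ^^ K) v = 0"
  shows "(\<Sum>n<Suc K. (((inverse q)\<^sup>2) ^ n * exp_coeff n) *s (N ^^ n) v) = E (x (y v))"
proof -
  let ?g = "inverse q * (q - inverse q)"
  have "(N ^^ Suc K) v = 0" for v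
    using assms by (simp add: T.zero)
  then have "E v = (\<Sum>n<Suc K. exp_coeff n *s (N ^^ n) v)"
    by (rule E_eq_sum)
  also have "\<dots> = v + (\<Sum>n<K. exp_coeff (Suc n) *s (N ^^ Suc n) v)"
    unfolding sum.lessThan_Suc_shift by (simp add: exp_coeff_0)
  also have "\<dots> = v + (\<Sum>n<K. (((inverse q)\<^sup>2) ^ Suc n * exp_coeff (Suc n)) *s (N ^^ Suc n) v)
      + (\<Sum>n<K. (?g * exp_coeff n) *s (N ^^ Suc n) v)"
    unfolding add.assoc sum.distrib[symmetric] scale_left_distrib[symmetric] exp_coeff_recursion ..
  also have "v + (\<Sum>n<K. (((inverse q)\<^sup>2) ^ Suc n * exp_coeff (Suc n)) *s (N ^^ Suc n) v)
      = (\<Sum>n<Suc K. (((inverse q)\<^sup>2) ^ n * exp_coeff n) *s (N ^^ n) v)"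
    unfolding sum.lessThan_Suc_shift by (simp add: exp_coeff_0)
  also have "(\<Sum>n<K. (?g * exp_coeff n) *s (N ^^ Suc n) v) = ?g *s E (N v)"
    unfolding E_eq_sum[OF assms] scale_sum_right by (simp add: funpow_swap1)
  finally show ?thesis
    by (simp add: xy E.diff E.scale)
qed

text \<open>
  Moving \<open>x\<close> through \<open>E\<close> from left to right rescales the argument of the exponential by \<open>q\<^sup>-\<^sup>2\<close>.
\<close>

lemma x_E: "x (E v) = E (x (y (x v)))"
proof -
  obtain K where K: "\<And>v. (N ^^ K) v = 0"
    using N_nilpotent by blast
  then have K': "(N ^^ Suc K) v = 0" for v
    by (simp add: T.zero)
  have "x ((N ^^ n) v) = ((inverse q)\<^sup>2) ^ n *s (N ^^ n) (x v)" for n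
    by (induction n) (simp_all add: x_N T.scale)
  then have "x (E v) = (\<Sum>n<Suc K. (((inverse q)\<^sup>2) ^ n * exp_coeff n) *s (N ^^ n) (x v))"
    by (simp add: E_eq_sum[OF K'] x.sum x.scale mult.commute del: sum.lessThan_Suc)
  also have "\<dots> = E (x (y (x v)))"
    by (rule E_rescale) (rule K)
  finally show ?thesis .
qed

text \<open>
  Moving \<open>y\<close> through \<open>E\<close> from right to left rescales the argument in the same way; since
  \<open>xy\<close> is a polynomial in \<open>N\<close>, it commutes with \<open>E\<close> and may be placed in front of it.
\<close>

lemma E_y: "E (y v) = y (x (y (E v)))"
proof -
  obtain K where K: "\<And>v. (N ^^ K) v = 0"
    using N_nilpotent by blast
  then have K': "(N ^^ Suc K) v = 0" for v
    by (simp add: T.zero)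
  have "(N ^^ n) (y v) = ((inverse q)\<^sup>2) ^ n *s y ((N ^^ n) v)" for n
    by (induction n) (simp_all add: N_y T.scale mult.commute)
  then have "E (y v) = y (\<Sum>n<Suc K. (((inverse q)\<^sup>2) ^ n * exp_coeff n) *s (N ^^ n) v)"
    by (simp add: E_eq_sum[OF K'] y.sum y.scale mult.commute del: sum.lessThan_Suc)
  also have "\<dots> = y (x (y (E v)))"
    unfolding E_rescale[OF K] by (simp add: xy E.diff E.scale E_N)
  finally show ?thesis .
qed

end

section \<open>The endomorphism ring and the action of the algebra\<close>

lemma monoid_End_ring:
  assumes "vector_space scale"
  shows "monoid (End_ring scale)"
proof -
  interpret vector_space scale by fact
  show ?thesis
    unfolding End_ring_def
    by (rule monoidI) (auto simp: linear_id o_assoc intro: Vector_Spaces.linear_compose)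
qed

text \<open>
  In \<^const>\<open>End_ring\<close> the inverse is defined by a description over the linear maps, so it is
  meaningful only if the inverse map is linear.
\<close>

lemma inv_End_ring:
  assumes "finite_dimensional_vector_space scale B"
    and lin: "Vector_Spaces.linear scale scale f" and "inj f"
  shows "inv\<^bsub>End_ring scale\<^esub> f \<circ> f = id" "f \<circ> inv\<^bsub>End_ring scale\<^esub> f = id"
proof -
  interpret finite_dimensional_vector_space scale B by fact
  interpret f: Vector_Spaces.linear scale scale f by fact
  interpret M: monoid "End_ring scale"
    by (rule monoid_End_ring) (rule vector_space_axioms)
  have surj: "surj f"
    by (rule linear_inj_imp_surj) fact+
  have "Vector_Spaces.linear scale scale (inv_into UNIV f)"
  proof (intro Vector_Spaces.linear.intro vector_space_axioms module_hom.intro module_axioms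
      module_hom_axioms.intro)
    show "inv_into UNIV f (x + y) = inv_into UNIV f x + inv_into UNIV f y" for x y
      using \<open>inj f\<close> surj by (intro inv_f_eq) (simp_all add: f.add surj_f_inv_f)
    show "inv_into UNIV f (scale c x) = scale c (inv_into UNIV f x)" for c x
      using \<open>inj f\<close> surj by (intro inv_f_eq) (simp_all add: f.scale surj_f_inv_f)
  qed
  moreover have 1: "inv_into UNIV f \<circ> f = id" "f \<circ> inv_into UNIV f = id"
    using \<open>inj f\<close> surj by (simp_all add: surj_iff)
  ultimately have "inv_into UNIV f = inv\<^bsub>End_ring scale\<^esub> f"
    using lin by (intro M.inv_unique') (simp_all add: End_ring_def)
  with 1 show "inv\<^bsub>End_ring scale\<^esub> f \<circ> f = id" "f \<circ> inv\<^bsub>End_ring scale\<^esub> f = id"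
    by simp_all
qed

lemma cls_in_carrier: "cls q a \<in> carrier (square_q q)"
  using ring_hom_closed[OF cls_hom] by (simp add: ring_of_type_algebra_def)

lemma cls_mult: "cls q (a * b) = cls q a \<otimes>\<^bsub>square_q q\<^esub> cls q b"
  using ring_hom_mult[OF cls_hom[of q], of a b] by (simp add: ring_of_type_algebra_def)

context
  fixes q :: "'f::field" and scale :: "'f \<Rightarrow> 'v::ab_group_add \<Rightarrow> 'v"
    and \<rho> :: "'f free_alg set \<Rightarrow> 'v \<Rightarrow> 'v"
  assumes module_V: "square_q_module q scale \<rho>"
begin

lemma module_hom_square_q: "\<rho> \<in> ring_hom (square_q q) (End_ring scale)"
  using module_V by (simp add: square_q_module_def)

lemma linear_action: "Vector_Spaces.linear scale scale (\<rho> (cls q a))"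
  using ring_hom_closed[OF module_hom_square_q cls_in_carrier] by (simp add: End_ring_def)

lemma action_mult: "\<rho> (cls q (a * b)) v = \<rho> (cls q a) (\<rho> (cls q b) v)"
  using ring_hom_mult[OF module_hom_square_q cls_in_carrier cls_in_carrier, of a b]
  by (simp add: cls_mult End_ring_def)

lemma action_add: "\<rho> (cls q (a + b)) v = \<rho> (cls q a) v + \<rho> (cls q b) v"
  using ring_hom_add[OF module_hom_square_q cls_in_carrier cls_in_carrier, of a b]
    ring_hom_add[OF cls_hom[of q], of a b]
  by (simp add: End_ring_def ring_of_type_algebra_def)

lemma action_diff: "\<rho> (cls q (a - b)) v = \<rho> (cls q a) v - \<rho> (cls q b) v"
  using action_add[of "a - b" b v] by simp

lemma action_scalar: "\<rho> (cls q (scalar c)) v = scale c v"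
  using module_V by (simp add: square_q_module_def)

lemma action_one: "\<rho> (cls q 1) v = v"
proof -
  interpret vector_space scale
    using module_V by (simp add: square_q_module_def)
  show ?thesis
    using action_scalar[of 1 v] by (simp add: scalar_one)
qed

lemmas action_simps = action_mult action_diff action_scalar action_one

end

theorem theorem8p2:
  fixes q :: "'f::alg_closed_field"
    and scale :: "'f \<Rightarrow> 'v::ab_group_add \<Rightarrow> 'v"
    and B :: "'v set"
    and \<rho> :: "'f free_alg set \<Rightarrow> 'v \<Rightarrow> 'v"
    and i :: 4
  assumes q_nonzero: "q \<noteq> 0"
    and q_not_root_of_unity: "\<forall>n::nat. n > 0 \<longrightarrow> q ^ n \<noteq> 1"
    and finite_dim: "finite_dimensional_vector_space scale B"
    and V_nonzero: "\<exists>v::'v. v \<noteq> 0"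
    and module_V: "square_q_module q scale \<rho>"
  shows "inv\<^bsub>End_ring scale\<^esub> (exp_q q scale (\<rho> (nfrak q i))) \<otimes>\<^bsub>End_ring scale\<^esub> \<rho> (sq_gen q i)
           \<otimes>\<^bsub>End_ring scale\<^esub> exp_q q scale (\<rho> (nfrak q i))
         = \<rho> (sq_gen q i \<otimes>\<^bsub>square_q q\<^esub> sq_gen q (i + 1) \<otimes>\<^bsub>square_q q\<^esub> sq_gen q i)
       \<and> exp_q q scale (\<rho> (nfrak q i)) \<otimes>\<^bsub>End_ring scale\<^esub> \<rho> (sq_gen q (i + 1))
           \<otimes>\<^bsub>End_ring scale\<^esub> inv\<^bsub>End_ring scale\<^esub> (exp_q q scale (\<rho> (nfrak q i)))
         = \<rho> (sq_gen q (i + 1) \<otimes>\<^bsub>square_q q\<^esub> sq_gen q i \<otimes>\<^bsub>square_q q\<^esub> sq_gen q (i + 1))"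
proof -
  let ?X = "\<rho> (sq_gen q i)" and ?Y = "\<rho> (sq_gen q (i + 1))" and ?N = "\<rho> (nfrak q i)"
  let ?d = "q - inverse q"
  interpret finite_dimensional_vector_space scale B by (rule finite_dim)
  note act = action_simps[OF module_V]
  have d: "?d \<noteq> 0"
    using q_not_root_of_unity[rule_format, of 2] q_nonzero
    by (auto simp: power2_eq_square field_simps)
  have N1: "?N v = scale (q / ?d) (v - ?X (?Y v))" for v
    by (simp add: nfrak_def sq_gen_def act)
  have N2: "?N v = scale (inverse q / ?d) (v - ?Y (?X v))" for v
    by (simp add: nfrak_alt[OF d] sq_gen_def act)
  have c: "inverse q * ?d * (q / ?d) = 1" "q * ?d * (inverse q / ?d) = 1"
  proof -
    have "inverse q * e * (q / e) = 1" "q * e * (inverse q / e) = 1" if "e \<noteq> 0" for e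
      using that q_nonzero by simp_all
    then show "inverse q * ?d * (q / ?d) = 1" "q * ?d * (inverse q / ?d) = 1"
      using d by blast+
  qed
  interpret q_weyl_pair q scale B ?X ?Y ?N
  proof (intro q_weyl_pair.intro alg_closed_endomorphism.intro fd_endomorphism.intro
      endomorphism.intro q_weyl_pair_axioms.intro finite_dim vector_space_axioms)
    show "Vector_Spaces.linear scale scale ?X" "Vector_Spaces.linear scale scale ?Y"
      "Vector_Spaces.linear scale scale ?N"
      by (simp_all add: sq_gen_def nfrak_def linear_action[OF module_V])
    show "q \<noteq> 0" "n > 0 \<Longrightarrow> q ^ n \<noteq> 1" for n
      using q_nonzero q_not_root_of_unity by auto
    show "?X (?Y v) = v - scale (inverse q * ?d) (?N v)" for v
      unfolding N1 scale_scale c by simp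
    show "?Y (?X v) = v - scale (q * ?d) (?N v)" for v
      unfolding N2 scale_scale c by simp
  qed
  \<comment> \<open>It remains to cancel \<open>E\<close> in the two intertwining relations.\<close>
  let ?I = "inv\<^bsub>End_ring scale\<^esub> E"
  have inv: "?I (E v) = v" "E (?I v) = v" for v
    using inv_End_ring[OF finite_dim linear_E inj_E] by (auto simp: fun_eq_iff)
  have mult: "f \<otimes>\<^bsub>End_ring scale\<^esub> g = f \<circ> g" for f g
    by (simp add: End_ring_def)
  have "?I \<circ> ?X \<circ> E = ?X \<circ> ?Y \<circ> ?X"
    by (simp add: fun_eq_iff x_E inv)
  moreover have "E \<circ> ?Y \<circ> ?I = ?Y \<circ> ?X \<circ> ?Y"
    by (simp add: fun_eq_iff E_y inv)
  moreover have "\<rho> (sq_gen q i \<otimes>\<^bsub>square_q q\<^esub> sq_gen q j \<otimes>\<^bsub>square_q q\<^esub> sq_gen q k)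
      = \<rho> (sq_gen q i) \<circ> \<rho> (sq_gen q j) \<circ> \<rho> (sq_gen q k)" for i j k
    by (simp add: sq_gen_def cls_mult[symmetric] action_mult[OF module_V] fun_eq_iff)
  ultimately show ?thesis
    unfolding mult E_def[symmetric] by simp
qed

end
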